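(* Let $\alpha>0$ and $n\ge 2$. Let $\mathbf m=(m_1,\dots,m_n)$ be a vector of positive masses that can be grouped into two sets of equal masses; that is, there are real numbers $a,b>0$ such that $m_i\in\{a,b\}$ for every $i\in\{1,\dots,n\}$. If the masses $m_1,\dots,m_n$ are not all equal, then there is no centered co-circular central configuration, for the power-law potential with exponent $\alpha$, with masses $\mathbf m$.
   Context: Power-law $n$-body problem with exponent $\alpha>0$: the potential is $U_\alpha=\sum_{i<j}\frac{m_im_j}{|q_i-q_j|^\alpha}$, for positive masses $m_1,\dots,m_n$ at distinct points $q_1,\dots,q_n$ of the plane $\mathbb C$. Centered co-circular central configuration with masses $\mathbf m=(m_1,\dots,m_n)$: the masses are placed at distinct points of the unit circle centered at the origin, $q_j=e^{\sqrt{-1}\,\theta_j}$ with $0<\theta_1<\theta_2<\cdots<\theta_n\le 2\pi$ (so the order of the entries of $\mathbf m$ is the cyclic order of the masses on the circle), and there is a real number $\lambda$ such that $$\sum_{j\ne k}\frac{m_j(q_j-q_k)}{r_{jk}^{\alpha+2}}+\frac{\lambda}{\alpha}\,q_k=0\qquad\text{for all }k\in\{1,\dots,n\},$$ where $r_{jk}=|q_j-q_k|$. (This is a central configuration lying on a circle whose center of mass is the center of that circle.) *)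

theory Defs
  imports "HOL-Analysis.Analysis"
begin

text \<open>
  Bodies are indexed by \<open>{1..n}\<close>; the values of \<open>m\<close>, \<open>q\<close> and \<open>\<theta>\<close> at other indices are
  irrelevant. The equation for body \<open>k\<close> is the gradient equation of
  \<open>U = (\<Sum>i<j. m i * m j / dist (q i) (q j) powr \<alpha>)\<close>, divided by \<open>\<alpha> * m k\<close>.
\<close>

definition central_config_eq ::
    "real \<Rightarrow> nat \<Rightarrow> (nat \<Rightarrow> real) \<Rightarrow> (nat \<Rightarrow> complex) \<Rightarrow> real \<Rightarrow> bool" where
  "central_config_eq \<alpha> n m q \<Lambda> \<longleftrightarrow>
     (\<forall>k\<in>{1..n}.
        (\<Sum>j\<in>{1..n} - {k}. (m j / dist (q j) (q k) powr (\<alpha> + 2)) *\<^sub>R (q j - q k))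
          + (\<Lambda> / \<alpha>) *\<^sub>R q k = 0)"

text \<open>
  The center of mass is not required separately to be the origin: for \<open>\<alpha> > 0\<close>, positive
  masses and \<open>n \<ge> 2\<close> this follows from the equations.
\<close>

definition centered_cocircular_cc ::
    "real \<Rightarrow> nat \<Rightarrow> (nat \<Rightarrow> real) \<Rightarrow> (nat \<Rightarrow> real) \<Rightarrow> bool" where
  "centered_cocircular_cc \<alpha> n m \<theta> \<longleftrightarrow>
     (\<forall>j\<in>{1..n}. 0 < \<theta> j \<and> \<theta> j \<le> 2 * pi) \<and>
     strict_mono_on {1..n} \<theta> \<and>
     (\<exists>\<Lambda>. central_config_eq \<alpha> n m (\<lambda>j. cis (\<theta> j)) \<Lambda>)"

end

theory Submission
  imports Defs
begin

text \<open>
  On the unit circle the equations say that \<open>\<theta>\<close> is a critical point of \<open>U\<close> and that all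
  potentials \<open>\<Sum>j. m j / r j k powr \<alpha>\<close> agree, with common value \<open>C\<close>. Since the interaction is a
  convex function of the angle on \<open>(0, 2 * pi)\<close>, the critical point minimises \<open>U\<close> among all
  configurations with the same cyclic order. Shifting the masses cyclically by one place therefore
  cannot decrease \<open>U\<close>, and together with the constancy of the potentials this makes the quadratic
  form of \<open>1 / r i j powr \<alpha>\<close> nonnegative at \<open>y i = m (i + 1) - m i\<close>. But if only two mass values
  occur, the nonzero entries of \<open>y\<close> are charges of equal size and alternating sign around the
  circle, and every charge has negative energy in the field of the others.
\<close>

section \<open>Pair interaction on the unit circle as a function of the angle\<close>

text \<open>
  Since \<open>0 powr x = 0\<close>, both functions vanish at \<open>0\<close>, so the self-interaction terms can be included
  in all sums.
\<close>

definition circ_pot :: "real \<Rightarrow> real \<Rightarrow> real" where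
  "circ_pot \<alpha> x = (2 * \<bar>sin (x / 2)\<bar>) powr (- \<alpha>)"

definition circ_force :: "real \<Rightarrow> real \<Rightarrow> real" where
  "circ_force \<alpha> x = sin x / (2 * \<bar>sin (x / 2)\<bar>) powr (\<alpha> + 2)"

lemma cos_eq_sin_half: "cos x = 1 - 2 * (sin (x / 2))\<^sup>2" for x :: real
  using cos_double_sin[of "x / 2"] by simp

lemma sin_half_add_2pi: "sin ((x + 2 * pi) / 2) = - sin (x / 2)"
  by (simp add: add_divide_distrib)

lemma dist_cis: "dist (cis s) (cis t) = 2 * \<bar>sin ((s - t) / 2)\<bar>"
proof -
  have "(dist (cis s) (cis t))\<^sup>2 = (cos s - cos t)\<^sup>2 + (sin s - sin t)\<^sup>2"
    by (simp add: dist_norm cmod_power2)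
  also have "\<dots> = 2 - 2 * cos (s - t)"
    using sin_cos_squared_add[of s] sin_cos_squared_add[of t]
    by (simp add: cos_diff power2_eq_square algebra_simps)
  also have "\<dots> = (2 * \<bar>sin ((s - t) / 2)\<bar>)\<^sup>2"
    by (simp add: cos_eq_sin_half[of "s - t"] power_mult_distrib)
  finally show ?thesis
    by (rule power2_eq_imp_eq) auto
qed

lemma circ_pot_minus [simp]: "circ_pot \<alpha> (- x) = circ_pot \<alpha> x"
  by (simp add: circ_pot_def)

lemma circ_pot_commute: "circ_pot \<alpha> (x - y) = circ_pot \<alpha> (y - x)"
  using circ_pot_minus[of \<alpha> "x - y"] by simp

lemma circ_pot_0 [simp]: "circ_pot \<alpha> 0 = 0"
  by (simp add: circ_pot_def)

lemma circ_pot_add_2pi [simp]: "circ_pot \<alpha> (x + 2 * pi) = circ_pot \<alpha> x"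
  by (simp only: circ_pot_def sin_half_add_2pi abs_minus)

lemma circ_pot_diff_2pi [simp]: "circ_pot \<alpha> (x - 2 * pi) = circ_pot \<alpha> x"
  using circ_pot_add_2pi[of \<alpha> "x - 2 * pi"] by simp

lemma circ_force_minus: "circ_force \<alpha> (- x) = - circ_force \<alpha> x"
  by (simp add: circ_force_def)

lemma circ_force_0 [simp]: "circ_force \<alpha> 0 = 0"
  by (simp add: circ_force_def)

lemma sin_half_pos: "0 < x \<Longrightarrow> x < 2 * pi \<Longrightarrow> 0 < sin (x / 2)"
  by (rule sin_gt_zero) auto

lemma circ_pot_pos: "0 < x \<Longrightarrow> x < 2 * pi \<Longrightarrow> 0 < circ_pot \<alpha> x"
  using sin_half_pos[of x] by (simp add: circ_pot_def)

lemma circ_pot_antimono: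
  assumes "0 < \<alpha>" "0 < x" "x \<le> y" "y \<le> pi"
  shows "circ_pot \<alpha> y \<le> circ_pot \<alpha> x"
proof -
  have "sin (x / 2) \<le> sin (y / 2)"
    by (rule sin_monotone_2pi_le) (use assms in auto)
  moreover have "0 < sin (x / 2)"
    using assms by (intro sin_half_pos) auto
  ultimately show ?thesis
    using assms by (auto simp: circ_pot_def intro!: powr_mono2')
qed

text \<open>The reflection \<open>x \<mapsto> 2 * pi - x\<close> preserves the potential and
  exchanges the two half circles.\<close>

lemma circ_pot_mono:
  assumes "0 < \<alpha>" "pi \<le> x" "x \<le> y" "y < 2 * pi"
  shows "circ_pot \<alpha> x \<le> circ_pot \<alpha> y"
  using circ_pot_antimono[of \<alpha> "2 * pi - y" "2 * pi - x"] assms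
    circ_pot_commute[of \<alpha> x "2 * pi"] circ_pot_commute[of \<alpha> y "2 * pi"] by simp

text \<open>The half-angle formula cancels one chord factor. What remains has no absolute value and
  can be differentiated directly.\<close>

lemma circ_force_eq:
  assumes "0 < x" "x < 2 * pi"
  shows "circ_force \<alpha> x = cos (x / 2) * (2 * sin (x / 2)) powr (- \<alpha> - 1)"
proof -
  let ?s = "2 * sin (x / 2)"
  have s: "0 < ?s" using sin_half_pos[OF assms] by simp
  have p2: "?s powr (\<alpha> + 2) = ?s * ?s powr (\<alpha> + 1)"
    using s powr_add[of ?s 1 "\<alpha> + 1"] by (simp add: add.commute)
  have p1: "?s powr (- \<alpha> - 1) = inverse (?s powr (\<alpha> + 1))"
    using powr_minus[of ?s "\<alpha> + 1"] by simp
  have sx: "sin x = ?s * cos (x / 2)"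
    using sin_double[of "x / 2"] by simp
  have cancel: "u * c / (u * p) = c * inverse p" if "0 < u" for u c p :: real
    using that by (simp add: divide_inverse)
  have "circ_force \<alpha> x = sin x / ?s powr (\<alpha> + 2)"
    using s by (simp add: circ_force_def)
  also have "\<dots> = ?s * cos (x / 2) / (?s * ?s powr (\<alpha> + 1))"
    by (simp only: sx p2)
  also have "\<dots> = cos (x / 2) * ?s powr (- \<alpha> - 1)"
    unfolding p1 by (rule cancel[OF s])
  finally show ?thesis .
qed

lemma circ_pot_deriv:
  assumes "0 < x" "x < 2 * pi"
  shows "(circ_pot \<alpha> has_real_derivative - \<alpha> * circ_force \<alpha> x) (at x)"
proof -
  note s = sin_half_pos[OF assms]
  have "((\<lambda>x. (2 * sin (x / 2)) powr (- \<alpha>)) has_real_derivative - \<alpha> * circ_force \<alpha> x) (at x)"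
    unfolding circ_force_eq[OF assms]
    by (rule derivative_eq_intros refl | use s in simp)+
  moreover have "\<forall>\<^sub>F y in nhds x. y \<in> {0<..<2 * pi}"
    using assms by (intro eventually_nhds_in_open) auto
  then have "\<forall>\<^sub>F y in nhds x. (2 * sin (y / 2)) powr (- \<alpha>) = circ_pot \<alpha> y"
    by eventually_elim (use sin_half_pos in \<open>force simp: circ_pot_def\<close>)
  ultimately show ?thesis
    using DERIV_cong_ev[OF refl _ refl] by fast
qed

text \<open>This is the convexity of the potential: \<open>circ_force\<close> is its derivative up
  to the negative factor \<open>- \<alpha>\<close>. On the open interval \<open>sin (x / 2)\<close>
  is positive, so both terms of the derivative are nonpositive.\<close>

lemma circ_force_deriv:
  assumes "0 < x" "x < 2 * pi" "0 < \<alpha>"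
  shows "\<exists>D. (circ_force \<alpha> has_real_derivative D) (at x) \<and> D \<le> 0"
proof -
  note s = sin_half_pos[OF assms(1,2)]
  let ?D = "- (sin (x / 2) / 2) * (2 * sin (x / 2)) powr (- \<alpha> - 1)
      - (\<alpha> + 1) * (cos (x / 2))\<^sup>2 * (2 * sin (x / 2)) powr (- \<alpha> - 2)"
  have "((\<lambda>x. cos (x / 2) * (2 * sin (x / 2)) powr (- \<alpha> - 1)) has_real_derivative ?D) (at x)"
    by (rule derivative_eq_intros refl | use s in \<open>simp add: power2_eq_square algebra_simps\<close>)+
  moreover have "\<forall>\<^sub>F y in nhds x. y \<in> {0<..<2 * pi}"
    using assms by (intro eventually_nhds_in_open) auto
  then have "\<forall>\<^sub>F y in nhds x. cos (y / 2) * (2 * sin (y / 2)) powr (- \<alpha> - 1) = circ_force \<alpha> y"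
    by eventually_elim (simp add: circ_force_eq)
  ultimately have "(circ_force \<alpha> has_real_derivative ?D) (at x)"
    using DERIV_cong_ev[OF refl _ refl] by fast
  moreover have "0 \<le> (sin (x / 2) / 2) * (2 * sin (x / 2)) powr (- \<alpha> - 1)"
    "0 \<le> (\<alpha> + 1) * (cos (x / 2))\<^sup>2 * (2 * sin (x / 2)) powr (- \<alpha> - 2)"
    using s assms(3) by simp_all
  ultimately show ?thesis
    by (intro exI[of _ ?D]) auto
qed

lemma circ_pot_above_tangent:
  assumes "0 < \<alpha>" "0 < x" "x < 2 * pi" "0 < y" "y < 2 * pi"
  shows "circ_pot \<alpha> x - \<alpha> * circ_force \<alpha> x * (y - x) \<le> circ_pot \<alpha> y"
proof -
  let ?S = "{0<..<2 * pi}"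
  obtain D where D: "(circ_force \<alpha> has_real_derivative D z) (at z)" "D z \<le> 0"
    if "z \<in> ?S" for z
    using circ_force_deriv[OF _ _ assms(1)] by (auto simp: Ball_def) metis
  have "convex_on ?S (circ_pot \<alpha>)"
  proof (rule f''_ge0_imp_convex)
    fix z assume z: "z \<in> ?S"
    show "(circ_pot \<alpha> has_real_derivative - \<alpha> * circ_force \<alpha> z) (at z)"
      using z by (intro circ_pot_deriv) auto
    show "((\<lambda>z. - \<alpha> * circ_force \<alpha> z) has_real_derivative - \<alpha> * D z) (at z)"
      by (intro DERIV_cmult D z)
    show "0 \<le> - \<alpha> * D z"
      using D(2)[OF z] assms(1) by (simp add: mult_nonneg_nonpos)
  qed auto
  then have "circ_pot \<alpha> y - circ_pot \<alpha> x \<ge> - \<alpha> * circ_force \<alpha> x * (y - x)"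
  proof (rule convex_on_imp_above_tangent)
    show "(circ_pot \<alpha> has_real_derivative - \<alpha> * circ_force \<alpha> x) (at x within ?S)"
      using circ_pot_deriv assms has_field_derivative_at_within by blast
  qed (use assms in \<open>auto intro: connected_Ioo simp: interior_open\<close>)
  then show ?thesis by simp
qed

section \<open>Radial and tangential components of the equations\<close>

text \<open>Multiplying the equation of body \<open>k\<close> by \<open>cis (- \<theta> k)\<close>
  rotates that body to \<open>1\<close>. The imaginary part is then the tangential force. Since
  \<open>1 - cos x\<close> is half the squared chord, the real part is the potential at
  \<open>k\<close> up to the factor \<open>-1/2\<close>, whence the common value
  \<open>2 * \<Lambda> / \<alpha>\<close>.\<close>

lemma centered_cocircular_components:
  assumes "0 < \<alpha>" "centered_cocircular_cc \<alpha> n m \<theta>"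
  obtains C where
    "\<And>k. k \<in> {1..n} \<Longrightarrow> (\<Sum>j\<in>{1..n}. m j * circ_pot \<alpha> (\<theta> j - \<theta> k)) = C"
    "\<And>k. k \<in> {1..n} \<Longrightarrow> (\<Sum>j\<in>{1..n}. m j * circ_force \<alpha> (\<theta> j - \<theta> k)) = 0"
proof -
  obtain \<Lambda> where \<Lambda>: "central_config_eq \<alpha> n m (\<lambda>j. cis (\<theta> j)) \<Lambda>"
    using assms(2) unfolding centered_cocircular_cc_def by blast
  have "(\<Sum>j\<in>{1..n}. m j * circ_pot \<alpha> (\<theta> j - \<theta> k)) = 2 * \<Lambda> / \<alpha> \<and>
      (\<Sum>j\<in>{1..n}. m j * circ_force \<alpha> (\<theta> j - \<theta> k)) = 0" if k: "k \<in> {1..n}" for k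
  proof -
    define c where "c j = m j / dist (cis (\<theta> j)) (cis (\<theta> k)) powr (\<alpha> + 2)" for j
    have c: "c j = m j / (2 * \<bar>sin ((\<theta> j - \<theta> k) / 2)\<bar>) powr (\<alpha> + 2)" for j
      by (simp add: c_def dist_cis)
    have "(\<Sum>j\<in>{1..n} - {k}. c j *\<^sub>R (cis (\<theta> j) - cis (\<theta> k))) + (\<Lambda> / \<alpha>) *\<^sub>R cis (\<theta> k) = 0"
      using \<Lambda> k unfolding central_config_eq_def c_def by blast
    then have "cis (- \<theta> k) * ((\<Sum>j\<in>{1..n} - {k}. c j *\<^sub>R (cis (\<theta> j) - cis (\<theta> k)))
        + (\<Lambda> / \<alpha>) *\<^sub>R cis (\<theta> k)) = 0"
      by simp
    then have eq: "(\<Sum>j\<in>{1..n} - {k}. c j *\<^sub>R (cis (\<theta> j - \<theta> k) - 1))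
        + of_real (\<Lambda> / \<alpha>) = 0"
      by (simp add: distrib_left sum_distrib_left right_diff_distrib cis_mult
          scaleR_conv_of_real[of "\<Lambda> / \<alpha>"] mult.left_commute[of "cis _"])
    have Re: "c j * (cos (\<theta> j - \<theta> k) - 1) = - (m j * circ_pot \<alpha> (\<theta> j - \<theta> k)) / 2" for j
    proof -
      let ?s = "2 * \<bar>sin ((\<theta> j - \<theta> k) / 2)\<bar>"
      have cs: "cos (\<theta> j - \<theta> k) - 1 = - (?s\<^sup>2) / 2"
        by (simp add: cos_eq_sin_half[of "\<theta> j - \<theta> k"] power_mult_distrib)
      show ?thesis
      \<comment> \<open>For chord length zero both sides vanish by the convention for
        \<open>powr\<close> at \<open>0\<close>.\<close>
      proof (cases "?s = 0")
        case True
        then show ?thesis unfolding c cs circ_pot_def by simp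
      next
        case False
        then have s: "?s > 0" by simp
        have "?s powr (- \<alpha>) = ?s\<^sup>2 / ?s powr (\<alpha> + 2)"
          using s powr_diff[of ?s 2 "\<alpha> + 2"] by (simp del: abs_mult)
        then show ?thesis unfolding c cs circ_pot_def by simp
      qed
    qed
    have "(\<Sum>j\<in>{1..n} - {k}. c j * (cos (\<theta> j - \<theta> k) - 1)) + \<Lambda> / \<alpha> = 0"
      using arg_cong[OF eq, of Re] by simp
    then have "(\<Sum>j\<in>{1..n} - {k}. m j * circ_pot \<alpha> (\<theta> j - \<theta> k)) = 2 * \<Lambda> / \<alpha>"
      unfolding Re by (simp add: sum_negf mult.commute flip: sum_divide_distrib)
    moreover have "(\<Sum>j\<in>{1..n} - {k}. m j * circ_force \<alpha> (\<theta> j - \<theta> k)) = 0"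
      using arg_cong[OF eq, of Im] by (simp add: c circ_force_def)
    ultimately show ?thesis
      using k by (simp add: sum.remove)
  qed
  then show thesis using that by blast
qed

section \<open>Cyclic sums and summation by parts\<close>

lemma sum_lessThan_cyclic_shift:
  fixes f :: "nat \<Rightarrow> 'a::ab_group_add"
  assumes "\<And>i. f (i + n) = f i"
  shows "(\<Sum>i<n. f (i + k)) = (\<Sum>i<n. f i)"
proof (induction k)
  case (Suc k)
  have "f k + (\<Sum>i<n. f (i + Suc k)) = (\<Sum>i<Suc n. f (i + k))"
    unfolding sum.lessThan_Suc_shift by simp
  also have "\<dots> = (\<Sum>i<n. f (i + k)) + f k"
    using assms[of k] by (simp add: add.commute)
  finally show ?case using Suc by simp
qed simp

text \<open>Abel summation as an induction that peels off the last term: the induction hypothesis is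
  used with the last weight \<open>g p\<close> as lower bound. Afterwards \<open>g p\<close> may be
  lowered to \<open>c\<close> because \<open>M\<close> stays below \<open>hi\<close>.\<close>

lemma sum_diff_mult_antimono_le:
  fixes M g :: "nat \<Rightarrow> real"
  assumes "\<And>i j. i \<le> j \<Longrightarrow> j < p \<Longrightarrow> g j \<le> g i" "\<And>j. j < p \<Longrightarrow> c \<le> g j"
    and "\<And>j. j \<le> p \<Longrightarrow> M j \<le> hi" "M 0 = hi"
  shows "(\<Sum>j<p. (M (Suc j) - M j) * g j) \<le> - c * (hi - M p)"
  using assms
proof (induction p arbitrary: c)
  case (Suc p)
  have "(\<Sum>j<p. (M (Suc j) - M j) * g j) \<le> - g p * (hi - M p)"
    using Suc.prems by (intro Suc.IH) auto
  then have "(\<Sum>j<Suc p. (M (Suc j) - M j) * g j) \<le> - g p * (hi - M (Suc p))"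
    by (simp add: algebra_simps)
  also have "\<dots> \<le> - c * (hi - M (Suc p))"
    using Suc.prems(2)[of p] Suc.prems(3)[of "Suc p"] by (simp add: mult_right_mono)
  finally show ?case .
qed simp

text \<open>Mirror image of the antitone case: the smallest weight now comes first, so the induction
  peels off the first term.\<close>

lemma sum_diff_mult_mono_le:
  fixes M g :: "nat \<Rightarrow> real"
  assumes "\<And>i j. i \<le> j \<Longrightarrow> j < p \<Longrightarrow> g i \<le> g j" "\<And>j. j < p \<Longrightarrow> c \<le> g j"
    and "\<And>j. j \<le> p \<Longrightarrow> lo \<le> M j" "M p = lo"
  shows "(\<Sum>j<p. (M (Suc j) - M j) * g j) \<le> - c * (M 0 - lo)"
  using assms
proof (induction p arbitrary: c M g)
  case (Suc p)
  have "(\<Sum>j<p. (M (Suc (Suc j)) - M (Suc j)) * g (Suc j)) \<le> - g 0 * (M (Suc 0) - lo)"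
    using Suc.prems by (intro Suc.IH) auto
  then have "(\<Sum>j<Suc p. (M (Suc j) - M j) * g j) \<le> - g 0 * (M 0 - lo)"
    unfolding sum.lessThan_Suc_shift by (simp add: algebra_simps)
  also have "\<dots> \<le> - c * (M 0 - lo)"
    using Suc.prems(2)[of 0] Suc.prems(3)[of 0] by (simp add: mult_right_mono)
  finally show ?case .
qed simp

text \<open>With one positive lower bound \<open>c\<close> for all weights, the decreasing part
  contributes at most \<open>- c * (hi - M p)\<close> and the increasing part at most
  \<open>- c * (M p - lo)\<close>. The value \<open>M p\<close> cancels.\<close>

lemma sum_diff_mult_unimodal_neg:
  fixes M g :: "nat \<Rightarrow> real"
  assumes "p \<le> L" "\<And>i j. i \<le> j \<Longrightarrow> j < p \<Longrightarrow> g j \<le> g i"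
    and "\<And>i j. p \<le> i \<Longrightarrow> i \<le> j \<Longrightarrow> j < L \<Longrightarrow> g i \<le> g j" "\<And>j. j < L \<Longrightarrow> 0 < g j"
    and "\<And>j. lo \<le> M j" "\<And>j. M j \<le> hi" "M 0 = hi" "M L = lo" "lo < hi"
  shows "(\<Sum>j<L. (M (Suc j) - M j) * g j) < 0"
proof -
  obtain c where c: "0 < c" "\<And>j. j < L \<Longrightarrow> c \<le> g j"
  proof
    \<comment> \<open>Inserting \<open>1\<close> keeps the set nonempty when there are no
      weights.\<close>
    show "0 < Min (insert 1 (g ` {..<L}))" using assms(4) by simp
  qed auto
  let ?t = "\<lambda>j. (M (Suc j) - M j) * g j"
  have "(\<Sum>j<L. ?t j) = (\<Sum>j<p. ?t j) + (\<Sum>j<L - p. ?t (p + j))"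
    using assms(1) sum.atLeastLessThan_concat[of 0 p L ?t]
      sum.shift_bounds_nat_ivl[of ?t 0 p "L - p"]
    by (simp add: lessThan_atLeast0 add.commute)
  moreover have "(\<Sum>j<p. ?t j) \<le> - c * (hi - M p)"
    using assms c by (intro sum_diff_mult_antimono_le) auto
  moreover have "(\<Sum>j<L - p. (M (p + Suc j) - M (p + j)) * g (p + j)) \<le> - c * (M (p + 0) - lo)"
    by (rule sum_diff_mult_mono_le[where M = "\<lambda>j. M (p + j)"]) (use assms c in auto)
  ultimately have "(\<Sum>j<L. ?t j) \<le> - c * (hi - lo)"
    by (simp add: algebra_simps)
  also have "\<dots> < 0" using c assms(9) by simp
  finally show ?thesis .
qed

section \<open>Charges at the jumps of the mass sequence\<close>

text \<open>
  The angles are lifted to a sequence indexed by all naturals that winds around the circle, so that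
  the bodies following body \<open>k\<close> are \<open>k + 1, \<dots>, k + n - 1\<close> for every \<open>k\<close>.
\<close>

locale winding =
  fixes n :: nat and \<alpha> :: real and T :: "nat \<Rightarrow> real"
  assumes n: "0 < n" and \<alpha>: "0 < \<alpha>"
    and T_mono: "strict_mono T" and T_period: "T (i + n) = T i + 2 * pi"
begin

lemma circ_pot_period [simp]:
  "circ_pot \<alpha> (T (i + n) - x) = circ_pot \<alpha> (T i - x)"
  "circ_pot \<alpha> (x - T (i + n)) = circ_pot \<alpha> (x - T i)"
  using circ_pot_add_2pi[of \<alpha> "T i - x"] circ_pot_diff_2pi[of \<alpha> "x - T i"]
  by (simp_all add: T_period algebra_simps)

lemma diff_bounds:
  assumes "i < j" "j < i + n"
  shows "0 < T j - T i" "T j - T i < 2 * pi"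
  using T_mono assms T_period[of i] unfolding strict_mono_def by (smt (verit))+

text \<open>Seen from \<open>T k\<close>, the potential falls up to the antipode and rises after it.
  Along the other bodies \<open>M\<close> runs from \<open>hi\<close> at \<open>Suc k\<close> down
  to \<open>lo\<close> at \<open>k + n\<close>, so the bound for unimodal weights applies.\<close>

lemma potential_neg_at_jump_up:
  fixes M :: "nat \<Rightarrow> real"
  assumes period: "\<And>i. M (i + n) = M i" and bounds: "\<And>i. lo \<le> M i" "\<And>i. M i \<le> hi"
    and jump: "M k = lo" "M (Suc k) = hi" "lo < hi"
  shows "(\<Sum>j<n. (M (Suc j) - M j) * circ_pot \<alpha> (T j - T k)) < 0"
proof -
  let ?x = "\<lambda>j. T (j + Suc k) - T k"
  let ?f = "\<lambda>j. (M (Suc j) - M j) * circ_pot \<alpha> (T j - T k)"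
  \<comment> \<open>\<open>L\<close> counts the bodies other than \<open>k\<close>.\<close>
  define L where "L = n - 1"
  have L: "n = Suc L" using n by (simp add: L_def)
  have f_period: "?f (i + n) = ?f i" for i
    using period[of i] period[of "Suc i"] by simp
  have x: "0 < ?x j" "?x j < 2 * pi" if "j < L" for j
    using that diff_bounds[of k "j + Suc k"] L by auto
  have x_mono: "?x i \<le> ?x j" if "i \<le> j" for i j
    using T_mono that by (simp add: strict_mono_less_eq)
  \<comment> \<open>\<open>p\<close> is the first of them at or beyond the antipode of
    \<open>T k\<close>, or \<open>L\<close> if there is none.\<close>
  define p where "p = (LEAST p. p = L \<or> pi \<le> ?x p)"
  have p: "p = L \<or> pi \<le> ?x p" unfolding p_def by (rule LeastI[of _ L]) simp
  have p_le: "p \<le> L" unfolding p_def by (rule Least_le) simp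
  have less_p: "?x j < pi" if "j < p" for j
    using not_less_Least[OF that[unfolded p_def]] by simp
  have "(\<Sum>j<L. (M (Suc j + Suc k) - M (j + Suc k)) * circ_pot \<alpha> (?x j)) < 0"
  proof (rule sum_diff_mult_unimodal_neg[where p = p and M = "\<lambda>j. M (j + Suc k)"])
    fix i j assume "i \<le> j" "j < p"
    then show "circ_pot \<alpha> (?x j) \<le> circ_pot \<alpha> (?x i)"
      using x(1)[of i] x_mono[of i j] less_p[of j] p_le \<alpha> by (intro circ_pot_antimono) auto
  next
    fix i j assume "p \<le> i" "i \<le> j" "j < L"
    then show "circ_pot \<alpha> (?x i) \<le> circ_pot \<alpha> (?x j)"
      using x(2)[of j] x_mono[of i j] x_mono[of p i] p \<alpha> by (intro circ_pot_mono) auto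
  next
    show "M (L + Suc k) = lo" using period[of k] jump L by (simp add: add.commute)
  qed (use p_le x bounds jump in \<open>auto intro: circ_pot_pos\<close>)
  moreover have "(\<Sum>j<n. ?f j) = (\<Sum>j<n. ?f (j + Suc k))"
    by (rule sum_lessThan_cyclic_shift[where f = ?f, symmetric]) (rule f_period)
  \<comment> \<open>The remaining index is \<open>k + n\<close>, which is body \<open>k\<close>
    itself; its self-interaction is zero.\<close>
  moreover have "?f (L + Suc k) = 0"
    using f_period[of k] by (simp add: L add.commute)
  ultimately show ?thesis
    by (simp only: L sum.lessThan_Suc add_Suc)
qed

lemma potential_mult_neg_at_jump:
  fixes M :: "nat \<Rightarrow> real"
  assumes period: "\<And>i. M (i + n) = M i" and vals: "\<And>i. M i = lo \<or> M i = hi"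
    and "lo < hi" "M (Suc k) \<noteq> M k"
  shows "(M (Suc k) - M k) * (\<Sum>j<n. (M (Suc j) - M j) * circ_pot \<alpha> (T j - T k)) < 0"
proof -
  have bounds: "lo \<le> M i" "M i \<le> hi" for i
    using vals[of i] assms(3) by auto
  consider "M k = lo" "M (Suc k) = hi" | "M k = hi" "M (Suc k) = lo"
    using vals[of k] vals[of "Suc k"] assms(4) by metis
  then show ?thesis
  proof cases
    case 1
    then show ?thesis
      using potential_neg_at_jump_up[OF period bounds 1 assms(3)] assms(3)
      by (simp add: mult_pos_neg)
  next
    \<comment> \<open>Negating \<open>M\<close> turns the downward jump into an upward one and flips
      the sign of the potential.\<close>
    case 2
    have "(\<Sum>j<n. ((- M (Suc j)) - (- M j)) * circ_pot \<alpha> (T j - T k)) < 0"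
      by (rule potential_neg_at_jump_up[where M = "\<lambda>j. - M j" and lo = "- hi" and hi = "- lo"])
        (use period bounds 2 assms(3) in auto)
    also have "(\<Sum>j<n. ((- M (Suc j)) - (- M j)) * circ_pot \<alpha> (T j - T k)) =
        - (\<Sum>j<n. (M (Suc j) - M j) * circ_pot \<alpha> (T j - T k))"
      unfolding sum_negf[symmetric] by (rule sum.cong) (simp_all add: algebra_simps)
    finally show ?thesis
      using 2 assms(3) by (simp add: mult_neg_pos)
  qed
qed

section \<open>Minimality of critical configurations\<close>

text \<open>The tangent-line inequalities for all pairs are added with weights
  \<open>M i * M j\<close>. The linear terms add up to the derivative of the energy along the
  displacement, which vanishes by \<open>critical\<close>.\<close>

lemma energy_ge_critical:
  fixes M :: "nat \<Rightarrow> real"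
  assumes T': "winding n \<alpha> T'" and pos: "\<And>i. 0 \<le> M i"
    and critical: "\<And>k. k < n \<Longrightarrow> (\<Sum>j<n. M j * circ_force \<alpha> (T j - T k)) = 0"
  shows "(\<Sum>i<n. \<Sum>j<n. M i * M j * circ_pot \<alpha> (T j - T i))
    \<le> (\<Sum>i<n. \<Sum>j<n. M i * M j * circ_pot \<alpha> (T' j - T' i))"
proof -
  interpret T': winding n \<alpha> T' by fact
  define d where "d i = T' i - T i" for i
  have less: "circ_pot \<alpha> (T j - T i) - \<alpha> * circ_force \<alpha> (T j - T i) * (d j - d i)
      \<le> circ_pot \<alpha> (T' j - T' i)" if "i < j" "j < n" for i j
    using circ_pot_above_tangent[of \<alpha> "T j - T i" "T' j - T' i"] diff_bounds[of i j]
      T'.diff_bounds[of i j] that \<alpha> by (simp add: d_def algebra_simps)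
  have tangent: "circ_pot \<alpha> (T j - T i) - \<alpha> * circ_force \<alpha> (T j - T i) * (d j - d i)
      \<le> circ_pot \<alpha> (T' j - T' i)" if ij: "i < n" "j < n" for i j
  \<comment> \<open>The inequality is symmetric in \<open>i\<close> and \<open>j\<close>, as the
    potential is even and the force odd. On the diagonal both sides are \<open>0\<close>.\<close>
  proof (cases i j rule: linorder_cases)
    case greater
    have "circ_force \<alpha> (T j - T i) = - circ_force \<alpha> (T i - T j)"
      using circ_force_minus[of \<alpha> "T i - T j"] by simp
    then show ?thesis
      using less[OF greater ij(1)] circ_pot_commute[of \<alpha> "T i"] circ_pot_commute[of \<alpha> "T' i"]
      by (simp add: algebra_simps)
  qed (use ij less in auto)
  let ?F = "\<lambda>i j. M i * M j * circ_force \<alpha> (T j - T i)"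
  have row: "(\<Sum>i<n. \<Sum>j<n. ?F i j * d i) = 0"
  proof -
    have "(\<Sum>j<n. ?F i j * d i) = M i * d i * (\<Sum>j<n. M j * circ_force \<alpha> (T j - T i))" for i
      unfolding sum_distrib_left by (rule sum.cong) (simp_all add: ac_simps)
    then show ?thesis by (simp add: critical)
  qed
  \<comment> \<open>Antisymmetry of the force reduces the terms with \<open>d j\<close> to those
    with \<open>d i\<close>.\<close>
  have anti: "?F i j * d j = - (?F j i * d j)" for i j
    using circ_force_minus[of \<alpha> "T i - T j"] by simp
  have "(\<Sum>i<n. \<Sum>j<n. ?F i j * d j) = (\<Sum>j<n. \<Sum>i<n. ?F i j * d j)"
    by (rule sum.swap)
  also have "\<dots> = (\<Sum>j<n. \<Sum>i<n. - (?F j i * d j))"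
    by (intro sum.cong refl anti)
  also have "\<dots> = - (\<Sum>j<n. \<Sum>i<n. ?F j i * d j)"
    by (simp only: sum_negf)
  finally have col: "(\<Sum>i<n. \<Sum>j<n. ?F i j * d j) = 0"
    using row by simp
  have "(\<Sum>i<n. \<Sum>j<n. M i * M j * circ_pot \<alpha> (T j - T i))
      = (\<Sum>i<n. \<Sum>j<n. M i * M j * circ_pot \<alpha> (T j - T i))
        - \<alpha> * ((\<Sum>i<n. \<Sum>j<n. ?F i j * d j) - (\<Sum>i<n. \<Sum>j<n. ?F i j * d i))"
    unfolding row col by simp
  also have "\<dots> = (\<Sum>i<n. \<Sum>j<n. M i * M j * circ_pot \<alpha> (T j - T i)
      - \<alpha> * (?F i j * d j - ?F i j * d i))"
    by (simp only: sum_subtractf flip: sum_distrib_left)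
  also have "\<dots> = (\<Sum>i<n. \<Sum>j<n. M i * M j *
      (circ_pot \<alpha> (T j - T i) - \<alpha> * circ_force \<alpha> (T j - T i) * (d j - d i)))"
    by (intro sum.cong refl) (simp add: algebra_simps)
  also have "\<dots> \<le> (\<Sum>i<n. \<Sum>j<n. M i * M j * circ_pot \<alpha> (T' j - T' i))"
    using tangent pos by (intro sum_mono mult_left_mono) auto
  finally show ?thesis .
qed

lemma winding_Suc: "winding n \<alpha> (\<lambda>i. T (Suc i))"
proof
  show "strict_mono (\<lambda>i. T (Suc i))"
    using T_mono by (simp add: strict_mono_def)
  show "T (Suc (i + n)) = T (Suc i) + 2 * pi" for i
    using T_period[of "Suc i"] by simp
qed (use n \<alpha> in auto)

section \<open>The cyclic shift and the quadratic form\<close>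

lemma two_valued_masses_constant:
  fixes M :: "nat \<Rightarrow> real"
  assumes period: "\<And>i. M (i + n) = M i" and vals: "\<And>i. M i = lo \<or> M i = hi"
    and "0 < lo" "lo < hi"
    and critical: "\<And>k. k < n \<Longrightarrow> (\<Sum>j<n. M j * circ_force \<alpha> (T j - T k)) = 0"
    and const: "\<And>k. k < n \<Longrightarrow> (\<Sum>j<n. M j * circ_pot \<alpha> (T j - T k)) = C"
  shows "M i = M 0"
proof (rule ccontr)
  assume "M i \<noteq> M 0"
  interpret S: winding n \<alpha> "\<lambda>i. T (Suc i)" by (rule winding_Suc)
  \<comment> \<open>\<open>A\<close> is the interaction matrix of the places one step further on.
    Paired with \<open>M (Suc i)\<close> it gives the original configuration, paired with
    \<open>M i\<close> the one in which every mass has moved on by one place.\<close>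
  define A where "A i j = circ_pot \<alpha> (T (Suc j) - T (Suc i))" for i j
  define y where "y i = M (Suc i) - M i" for i
  have y_period: "y (i + n) = y i" for i
    using period[of i] period[of "Suc i"] by (simp add: y_def)
  have A_sym: "A i j = A j i" for i j
    unfolding A_def by (rule circ_pot_commute)
  have pot_all: "(\<Sum>j<n. M j * circ_pot \<alpha> (T j - T k)) = C" for k
  proof -
    have "k = k mod n + k div n * n" by simp
    moreover have "(\<Sum>j<n. M j * circ_pot \<alpha> (T j - T (k mod n + l * n))) = C" for l
    proof (induction l)
      case (Suc l)
      have "k mod n + Suc l * n = (k mod n + l * n) + n" by simp
      then show ?case using Suc by (simp only: circ_pot_period)
    qed (use const n in simp)
    ultimately show ?thesis by metis
  qed
  have const_A: "(\<Sum>j<n. M (Suc j) * A i j) = C" for i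
    using sum_lessThan_cyclic_shift[where k = 1 and n = n
        and f = "\<lambda>j. M j * circ_pot \<alpha> (T j - T (Suc i))"] pot_all[of "Suc i"] period
    by (simp add: A_def)
  have total: "(\<Sum>i<n. M (Suc i)) = (\<Sum>i<n. M i)"
    using sum_lessThan_cyclic_shift[where k = 1 and f = M and n = n] period by simp
  have factor: "(\<Sum>i<n. \<Sum>j<n. p i * q j * B i j) = (\<Sum>i<n. p i * (\<Sum>j<n. q j * B i j))"
    for p q :: "nat \<Rightarrow> real" and B
    by (simp add: sum_distrib_left mult.assoc)
  have "(\<Sum>i<n. \<Sum>j<n. M i * M j * circ_pot \<alpha> (T j - T i)) = (\<Sum>i<n. M i) * C"
    using const by (simp add: factor flip: sum_distrib_right)
  moreover have "(\<Sum>i<n. \<Sum>j<n. M i * M j * circ_pot \<alpha> (T j - T i))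
      \<le> (\<Sum>i<n. \<Sum>j<n. M i * M j * A i j)"
    unfolding A_def
  proof (rule energy_ge_critical[OF winding_Suc])
    show "0 \<le> M i" for i using vals[of i] assms(3,4) by auto
  qed (rule critical)
  \<comment> \<open>The shifted energy is the only one of the four sums that is not determined by
    \<open>C\<close>; minimality bounds it from below.\<close>
  ultimately have MM: "(\<Sum>i<n. M i) * C \<le> (\<Sum>i<n. \<Sum>j<n. M i * M j * A i j)"
    by simp
  have SS: "(\<Sum>i<n. \<Sum>j<n. M (Suc i) * M (Suc j) * A i j) = (\<Sum>i<n. M i) * C"
    by (simp add: factor const_A total flip: sum_distrib_right)
  have MS: "(\<Sum>i<n. \<Sum>j<n. M i * M (Suc j) * A i j) = (\<Sum>i<n. M i) * C"
    by (simp add: factor const_A flip: sum_distrib_right)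
  have "(\<Sum>i<n. \<Sum>j<n. M (Suc i) * M j * A i j) = (\<Sum>j<n. \<Sum>i<n. M (Suc i) * M j * A i j)"
    by (rule sum.swap)
  also have "\<dots> = (\<Sum>i<n. \<Sum>j<n. M i * M (Suc j) * A i j)"
    by (intro sum.cong refl) (simp add: A_sym)
  finally have SM: "(\<Sum>i<n. \<Sum>j<n. M (Suc i) * M j * A i j) = (\<Sum>i<n. M i) * C"
    unfolding MS .
  \<comment> \<open>In the expansion, \<open>SS\<close>, \<open>MS\<close> and \<open>SM\<close>
    contribute \<open>1 - 1 - 1\<close> times \<open>(\<Sum>i<n. M i) * C\<close>, and
    \<open>MM\<close> compensates for the resulting deficit.\<close>
  have "(\<Sum>i<n. y i * (\<Sum>j<n. y j * A i j)) = (\<Sum>i<n. \<Sum>j<n. M (Suc i) * M (Suc j) * A i j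
      - M i * M (Suc j) * A i j - M (Suc i) * M j * A i j + M i * M j * A i j)"
    unfolding factor[symmetric] y_def by (intro sum.cong refl) (simp add: algebra_simps)
  also have "\<dots> =
      (\<Sum>i<n. \<Sum>j<n. M (Suc i) * M (Suc j) * A i j) - (\<Sum>i<n. \<Sum>j<n. M i * M (Suc j) * A i j)
      - (\<Sum>i<n. \<Sum>j<n. M (Suc i) * M j * A i j) + (\<Sum>i<n. \<Sum>j<n. M i * M j * A i j)"
    by (simp only: sum_subtractf sum.distrib)
  finally have "(\<Sum>i<n. y i * (\<Sum>j<n. y j * A i j)) =
      (\<Sum>i<n. \<Sum>j<n. M (Suc i) * M (Suc j) * A i j) - (\<Sum>i<n. \<Sum>j<n. M i * M (Suc j) * A i j)
      - (\<Sum>i<n. \<Sum>j<n. M (Suc i) * M j * A i j) + (\<Sum>i<n. \<Sum>j<n. M i * M j * A i j)" .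
  with MM SS MS SM have "0 \<le> (\<Sum>i<n. y i * (\<Sum>j<n. y j * A i j))"
    by simp
  moreover have neg: "y k * (\<Sum>j<n. y j * A k j) < 0" if "y k \<noteq> 0" for k
    unfolding y_def A_def
    by (rule S.potential_mult_neg_at_jump[where M = M and lo = lo and hi = hi])
      (use period vals assms(4) that in \<open>simp_all add: y_def\<close>)
  \<comment> \<open>If no jump occurred within one period, periodicity would make \<open>M\<close>
    constant.\<close>
  moreover have "\<exists>k<n. y k \<noteq> 0"
  proof (rule ccontr)
    assume 0: "\<not> ?thesis"
    have "y k = 0" for k
    proof -
      have "y (k mod n + l * n) = y (k mod n)" for l
      proof (induction l)
        case (Suc l)
        have "k mod n + Suc l * n = (k mod n + l * n) + n" by simp
        then show ?case using Suc by (simp only: y_period)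
      qed simp
      then have "y k = y (k mod n)" by (metis mod_div_mult_eq)
      then show ?thesis using 0 n by simp
    qed
    then have "M (Suc j) = M j" for j by (simp add: y_def)
    then have "M i = M 0" by (induction i) auto
    with \<open>M i \<noteq> M 0\<close> show False by simp
  qed
  then obtain k where "k < n" "y k \<noteq> 0" by blast
  then have "(\<Sum>i<n. y i * (\<Sum>j<n. y j * A i j)) < (\<Sum>i<n. 0)"
  proof (intro sum_strict_mono_ex1)
    show "\<forall>i\<in>{..<n}. y i * (\<Sum>j<n. y j * A i j) \<le> 0"
      using neg by (metis less_imp_le mult_zero_left order_refl)
  qed (use neg in auto)
  ultimately show False by simp
qed

end

section \<open>From the given angles to the winding sequence\<close>

theorem theorem2:
  fixes \<alpha> a b :: real and n :: nat and m :: "nat \<Rightarrow> real"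
  assumes "\<alpha> > 0" and "n \<ge> 2"
    and "a > 0" and "b > 0"
    and "\<forall>i\<in>{1..n}. m i \<in> {a, b}"
    and "\<exists>i\<in>{1..n}. \<exists>j\<in>{1..n}. m i \<noteq> m j"
  shows "\<not> (\<exists>\<theta> :: nat \<Rightarrow> real. centered_cocircular_cc \<alpha> n m \<theta>)"
proof
  assume "\<exists>\<theta>. centered_cocircular_cc \<alpha> n m \<theta>"
  then obtain \<theta> where cc: "centered_cocircular_cc \<alpha> n m \<theta>" by blast
  obtain C where
    pot: "\<And>k. k \<in> {1..n} \<Longrightarrow> (\<Sum>j\<in>{1..n}. m j * circ_pot \<alpha> (\<theta> j - \<theta> k)) = C" and
    force: "\<And>k. k \<in> {1..n} \<Longrightarrow> (\<Sum>j\<in>{1..n}. m j * circ_force \<alpha> (\<theta> j - \<theta> k)) = 0"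
    using centered_cocircular_components[OF assms(1) cc] by blast
  have mono: "\<And>i j. i \<in> {1..n} \<Longrightarrow> j \<in> {1..n} \<Longrightarrow> i < j \<Longrightarrow> \<theta> i < \<theta> j"
    and range: "\<And>j. j \<in> {1..n} \<Longrightarrow> 0 < \<theta> j \<and> \<theta> j \<le> 2 * pi"
    using cc unfolding centered_cocircular_cc_def strict_mono_on_def by auto
  \<comment> \<open>Indices now start at \<open>0\<close>: index \<open>i\<close> stands for body
    \<open>Suc (i mod n)\<close>, and \<open>i div n\<close> counts completed turns.\<close>
  define M where "M i = m (Suc (i mod n))" for i
  define T where "T i = \<theta> (Suc (i mod n)) + 2 * pi * real (i div n)" for i
  have n: "0 < n" using assms(2) by simp
  interpret winding n \<alpha> T
  proof
    show "T (i + n) = T i + 2 * pi" for i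
      using n by (simp add: T_def algebra_simps)
    show "strict_mono T"
      unfolding strict_mono_Suc_iff
    proof
      fix i
      show "T i < T (Suc i)"
      proof (cases "Suc (i mod n) = n")
        \<comment> \<open>From the last body to the first of the next turn, the step is increasing
          because \<open>\<theta> n \<le> 2 * pi\<close> and \<open>0 < \<theta> 1\<close>.\<close>
        case True
        then have "Suc i mod n = 0" "Suc i div n = Suc (i div n)"
          by (simp_all add: mod_Suc div_Suc)
        then show ?thesis
          using range[of 1] range[of n] True n by (simp add: T_def algebra_simps)
      next
        case False
        then have "Suc i mod n = Suc (i mod n)" "Suc i div n = i div n"
          by (simp_all add: mod_Suc div_Suc)
        moreover have "Suc (i mod n) < n"
          using False n by (simp add: le_neq_implies_less Suc_leI)
        ultimately show ?thesis
          using mono[of "Suc (i mod n)" "Suc (Suc (i mod n))"] by (simp add: T_def)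
      qed
    qed
  qed (use n assms in auto)
  have reindex: "(\<Sum>j\<in>{1..n}. f (m j) (\<theta> j)) = (\<Sum>j<n. f (M j) (T j))" for f :: "real \<Rightarrow> real \<Rightarrow> real"
    by (simp add: sum.atLeast1_atMost_eq M_def T_def)
  have T_less: "T k = \<theta> (Suc k)" if "k < n" for k
    using that by (simp add: T_def)
  have M_range: "M i \<in> {a, b}" for i
    using assms(5) n by (simp add: M_def Suc_le_eq)
  have "a \<noteq> b" using assms(5,6) by auto
  have M_const: "M i = M 0" for i
  proof (rule two_valued_masses_constant[where lo = "min a b" and hi = "max a b" and C = C])
    show "M (i + n) = M i" for i by (simp add: M_def)
    show "M i = min a b \<or> M i = max a b" for i using M_range[of i] by (auto simp: min_def max_def)
    show "0 < min a b" "min a b < max a b" using assms \<open>a \<noteq> b\<close> by auto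
    fix k assume k: "k < n"
    show "(\<Sum>j<n. M j * circ_force \<alpha> (T j - T k)) = 0"
      using force[of "Suc k"] k reindex[of "\<lambda>x t. x * circ_force \<alpha> (t - T k)"] by (simp add: T_less)
    show "(\<Sum>j<n. M j * circ_pot \<alpha> (T j - T k)) = C"
      using pot[of "Suc k"] k reindex[of "\<lambda>x t. x * circ_pot \<alpha> (t - T k)"] by (simp add: T_less)
  qed
  have "m i = M 0" if "i \<in> {1..n}" for i
    using M_const[of "i - 1"] that by (cases i) (simp_all add: M_def)
  then show False using assms(6) by metis
qed

end
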